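(* Let $A$ be a stably finite simple unital C*-algebra such that $\mathrm{RR}(A)=0$ and the order on projections over $A$ is determined by traces. Let $\alpha\in\mathrm{Aut}(A)$, and suppose that the homeomorphism of $T(A)$ given by $\tau\mapsto\tau\circ\alpha$ has finite order. If $\alpha$ has the Rokhlin property, then $\alpha$ has the tracial Rokhlin property.
   Context: $T(A)$ is the set of tracial states of $A$ with the weak* topology; each $\tau\in T(A)$ is extended (unnormalized, i.e. as $\mathrm{Tr}\otimes\tau$) to $M_\infty(A)=\bigcup_{n\ge 1}M_n(A)$. $p\precsim q$ means $p$ is Murray-von Neumann equivalent to a subprojection of $q$. "The order on projections over $A$ is determined by traces" means: whenever $p,q\in M_\infty(A)$ are projections with $\tau(p)<\tau(q)$ for all $\tau\in T(A)$, then $p\precsim q$. $\mathrm{RR}(A)=0$ (real rank zero): the invertible selfadjoint elements are dense in the selfadjoint elements. Rokhlin property of $\alpha\in\mathrm{Aut}(A)$: for every finite set $F\subset A$, every $\varepsilon>0$, and every $n\in\mathbb{N}$ there are mutually orthogonal projections $e_0,\dots,e_{n-1},f_0,\dots,f_n\in A$ such that: (1) $\|\alpha(e_j)-e_{j+1}\|<\varepsilon$ for $0\le j\le n-2$ and $\|\alpha(f_j)-f_{j+1}\|<\varepsilon$ for $0\le j\le n-1$; (2) $\|e_ja-ae_j\|<\varepsilon$ for $0\le j\le n-1$ and $\|f_ja-af_j\|<\varepsilon$ for $0\le j\le n$, for all $a\in F$; (3) $\sum_{j=0}^{n-1}e_j+\sum_{j=0}^n f_j=1$. Tracial Rokhlin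 property of $\alpha\in\mathrm{Aut}(A)$ ($A$ stably finite simple unital): for every finite set $F\subset A$, every $\varepsilon>0$, every $n\in\mathbb{N}$, and every nonzero positive $x\in A$, there are mutually orthogonal projections $e_0,e_1,\dots,e_n\in A$ such that: (1) $\|\alpha(e_j)-e_{j+1}\|<\varepsilon$ for $0\le j\le n-1$; (2) $\|e_ja-ae_j\|<\varepsilon$ for $0\le j\le n$ and all $a\in F$; (3) with $e=\sum_{j=0}^n e_j$, the projection $1-e$ is Murray-von Neumann equivalent to a projection in the hereditary subalgebra $\overline{xAx}$ of $A$ generated by $x$. *)

theory Defs
  imports "HOL-Analysis.Analysis" "HOL-Library.Complex_Order"
begin

section \<open>Unital C*-algebras\<close>

text \<open>
  Nonzero unital complex C*-algebras as a type class. The class \<open>real_normed_algebra_1\<close>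
  contributes a submultiplicative norm with \<open>norm 1 = 1\<close>, which by the C*-identity holds in every
  nonzero unital C*-algebra.
\<close>

class cstar_algebra = real_normed_algebra_1 + banach +
  fixes scaleC :: "complex \<Rightarrow> 'a \<Rightarrow> 'a"  (infixr "*\<^sub>C" 75)
    and star :: "'a \<Rightarrow> 'a"
  assumes scaleC_add_right: "c *\<^sub>C (x + y) = c *\<^sub>C x + c *\<^sub>C y"
    and scaleC_add_left: "(c + d) *\<^sub>C x = c *\<^sub>C x + d *\<^sub>C x"
    and scaleC_scaleC: "c *\<^sub>C (d *\<^sub>C x) = (c * d) *\<^sub>C x"
    and scaleC_complex_of_real: "complex_of_real r *\<^sub>C x = r *\<^sub>R x"
    and mult_scaleC_left: "(c *\<^sub>C x) * y = c *\<^sub>C (x * y)"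
    and mult_scaleC_right: "x * (c *\<^sub>C y) = c *\<^sub>C (x * y)"
    and norm_scaleC: "norm (c *\<^sub>C x) = cmod c * norm x"
    and star_star: "star (star x) = x"
    and star_add: "star (x + y) = star x + star y"
    and star_scaleC: "star (c *\<^sub>C x) = cnj c *\<^sub>C star x"
    and star_mult: "star (x * y) = star y * star x"
    and norm_star_mult_self: "norm (star x * x) = (norm x)\<^sup>2"

definition selfadjoint :: "'a::cstar_algebra \<Rightarrow> bool" where
  "selfadjoint a \<longleftrightarrow> star a = a"

definition positive :: "'a::cstar_algebra \<Rightarrow> bool" where
  "positive a \<longleftrightarrow> (\<exists>b. a = star b * b)"

definition projection :: "'a::cstar_algebra \<Rightarrow> bool" where
  "projection p \<longleftrightarrow> star p = p \<and> p * p = p"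

definition mvn_equiv :: "'a::cstar_algebra \<Rightarrow> 'a \<Rightarrow> bool" where
  "mvn_equiv p q \<longleftrightarrow> (\<exists>v. star v * v = p \<and> v * star v = q)"

definition hereditary_subalgebra :: "'a::cstar_algebra \<Rightarrow> 'a set" where
  "hereditary_subalgebra x = closure {x * a * x | a. True}"

definition closed_ideal :: "'a::cstar_algebra set \<Rightarrow> bool" where
  "closed_ideal I \<longleftrightarrow> closed I \<and> 0 \<in> I \<and> (\<forall>a\<in>I. \<forall>b\<in>I. a + b \<in> I) \<and>
     (\<forall>c. \<forall>a\<in>I. c *\<^sub>C a \<in> I) \<and> (\<forall>x. \<forall>a\<in>I. x * a \<in> I \<and> a * x \<in> I)"

definition simple_cstar :: "'a::cstar_algebra itself \<Rightarrow> bool" where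
  "simple_cstar _ \<longleftrightarrow> (\<forall>I::'a set. closed_ideal I \<longrightarrow> I = {0} \<or> I = UNIV)"

definition real_rank_zero :: "'a::cstar_algebra itself \<Rightarrow> bool" where
  "real_rank_zero _ \<longleftrightarrow>
     {a::'a. selfadjoint a} \<subseteq> closure {a. selfadjoint a \<and> (\<exists>b. a * b = 1 \<and> b * a = 1)}"

definition star_automorphism :: "('a::cstar_algebra \<Rightarrow> 'a) \<Rightarrow> bool" where
  "star_automorphism \<alpha> \<longleftrightarrow> bij \<alpha> \<and> (\<forall>x y. \<alpha> (x + y) = \<alpha> x + \<alpha> y) \<and>
     (\<forall>c x. \<alpha> (c *\<^sub>C x) = c *\<^sub>C \<alpha> x) \<and> (\<forall>x y. \<alpha> (x * y) = \<alpha> x * \<alpha> y) \<and>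
     (\<forall>x. \<alpha> (star x) = star (\<alpha> x))"

section \<open>Tracial states\<close>

text \<open>
  The inequality \<open>0 \<le> \<tau> (star x * x)\<close> is in \<open>\<complex>\<close>, so it includes that the value is real.
  Boundedness with norm 1 is automatic for a positive unital functional.
\<close>

definition tracial_states :: "('a::cstar_algebra \<Rightarrow> complex) set" where
  "tracial_states = {\<tau>. (\<forall>x y. \<tau> (x + y) = \<tau> x + \<tau> y) \<and> (\<forall>c x. \<tau> (c *\<^sub>C x) = c * \<tau> x) \<and>
     (\<forall>x. 0 \<le> \<tau> (star x * x)) \<and> \<tau> 1 = 1 \<and> (\<forall>x y. \<tau> (x * y) = \<tau> (y * x))}"

definition trace_map :: "('a::cstar_algebra \<Rightarrow> 'a) \<Rightarrow> ('a \<Rightarrow> complex) \<Rightarrow> ('a \<Rightarrow> complex)" where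
  "trace_map \<alpha> \<tau> = \<tau> \<circ> \<alpha>"

definition trace_map_finite_order :: "('a::cstar_algebra \<Rightarrow> 'a) \<Rightarrow> bool" where
  "trace_map_finite_order \<alpha> \<longleftrightarrow> (\<exists>m\<ge>1. \<forall>\<tau>\<in>tracial_states. (trace_map \<alpha> ^^ m) \<tau> = \<tau>)"

lemma star_automorphism_one:
  assumes "star_automorphism \<alpha>"
  shows "\<alpha> 1 = 1"
proof -
  obtain y where y: "\<alpha> y = 1"
    using assms by (metis star_automorphism_def bij_pointE)
  have "\<alpha> 1 = \<alpha> 1 * \<alpha> y" by (simp add: y)
  also have "\<dots> = 1" using assms y by (metis star_automorphism_def mult_1)
  finally show ?thesis .
qed

lemma star_automorphism_inv:
  assumes "star_automorphism \<alpha>"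
  shows "star_automorphism (inv \<alpha>)"
proof -
  have b: "bij \<alpha>" and s: "\<And>x. \<alpha> (inv \<alpha> x) = x" and i: "\<And>x. inv \<alpha> (\<alpha> x) = x"
    using assms by (auto simp: star_automorphism_def bij_is_surj surj_f_inv_f bij_is_inj)
  show ?thesis
    unfolding star_automorphism_def
    using assms[unfolded star_automorphism_def] s i bij_imp_bij_inv[OF b] by metis
qed

lemma trace_map_tracial_states:
  assumes "star_automorphism \<alpha>" and "\<tau> \<in> tracial_states"
  shows "trace_map \<alpha> \<tau> \<in> tracial_states"
  using assms star_automorphism_one[OF assms(1)]
  by (auto simp: tracial_states_def trace_map_def star_automorphism_def)

text \<open>
  The topology of \<open>'a \<Rightarrow> complex\<close> is that of pointwise convergence, so on \<open>tracial_states\<close> it is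
  the weak* topology.
\<close>

lemma trace_map_homeomorphism:
  assumes "star_automorphism \<alpha>"
  shows "homeomorphism tracial_states tracial_states (trace_map \<alpha>) (trace_map (inv \<alpha>))"
proof -
  have s: "\<And>x. \<alpha> (inv \<alpha> x) = x" and i: "\<And>x. inv \<alpha> (\<alpha> x) = x"
    using assms by (auto simp: star_automorphism_def bij_is_surj surj_f_inv_f bij_is_inj)
  have c: "continuous_on S (trace_map \<beta>)" for S and \<beta> :: "'a \<Rightarrow> 'a"
    unfolding trace_map_def comp_def
    by (intro continuous_on_coordinatewise_then_product continuous_on_subset[OF
          continuous_on_product_coordinates subset_UNIV])
  show ?thesis
    by (intro homeomorphismI c)
       (auto simp: trace_map_tracial_states star_automorphism_inv assms trace_map_def[unfolded comp_def] s i
          intro: trace_map_tracial_states[unfolded trace_map_def comp_def])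
qed

section \<open>Matrices over A\<close>

text \<open>
  \<open>mat_n n\<close> is $M_n(A)$, realised as the matrices indexed by \<open>nat \<times> nat\<close> that vanish outside
  the upper left \<open>n \<times> n\<close> corner; the embedding $a \mapsto \mathrm{diag}(a,0)$ then becomes an
  inclusion. The product and the trace are meaningful on \<open>mat_inf\<close> only, where the index sets of
  the sums are finite.
\<close>

type_synonym 'a imat = "nat \<Rightarrow> nat \<Rightarrow> 'a"

definition mat_n :: "nat \<Rightarrow> 'a::cstar_algebra imat set" where
  "mat_n n = {a. \<forall>i j. i \<ge> n \<or> j \<ge> n \<longrightarrow> a i j = 0}"

definition mat_inf :: "'a::cstar_algebra imat set" where
  "mat_inf = (\<Union>n\<in>{1..}. mat_n n)"

definition mat_mult :: "'a::cstar_algebra imat \<Rightarrow> 'a imat \<Rightarrow> 'a imat" where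
  "mat_mult a b = (\<lambda>i j. \<Sum>k | a i k \<noteq> 0. a i k * b k j)"

definition mat_star :: "'a::cstar_algebra imat \<Rightarrow> 'a imat" where
  "mat_star a = (\<lambda>i j. star (a j i))"

definition mat_unit :: "nat \<Rightarrow> 'a::cstar_algebra imat" where
  "mat_unit n = (\<lambda>i j. if i = j \<and> i < n then 1 else 0)"

definition mat_projections :: "'a::cstar_algebra imat set" where
  "mat_projections = {p \<in> mat_inf. mat_star p = p \<and> mat_mult p p = p}"

definition mat_mvn_equiv :: "'a::cstar_algebra imat \<Rightarrow> 'a imat \<Rightarrow> bool" where
  "mat_mvn_equiv p q \<longleftrightarrow>
     (\<exists>v\<in>mat_inf. mat_mult (mat_star v) v = p \<and> mat_mult v (mat_star v) = q)"

definition mat_subprojection :: "'a::cstar_algebra imat \<Rightarrow> 'a imat \<Rightarrow> bool" where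
  "mat_subprojection p q \<longleftrightarrow> p \<in> mat_projections \<and> mat_mult p q = p \<and> mat_mult q p = p"

definition mat_precsim :: "'a::cstar_algebra imat \<Rightarrow> 'a imat \<Rightarrow> bool" where
  "mat_precsim p q \<longleftrightarrow> (\<exists>r. mat_subprojection r q \<and> mat_mvn_equiv p r)"

text \<open>The unnormalised extension of \<open>\<tau>\<close> to matrices.\<close>

definition mat_trace :: "('a::cstar_algebra \<Rightarrow> complex) \<Rightarrow> 'a imat \<Rightarrow> complex" where
  "mat_trace \<tau> a = (\<Sum>i | a i i \<noteq> 0. \<tau> (a i i))"

text \<open>
  Stable finiteness: for every \<open>n\<close>, the unit of $M_n(A)$ is not equivalent to a proper
  subprojection. (Both relations do not depend on whether they are taken in $M_n(A)$ or in
  $M_\infty(A)$.)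
\<close>

definition stably_finite :: "'a::cstar_algebra itself \<Rightarrow> bool" where
  "stably_finite _ \<longleftrightarrow> (\<forall>n\<ge>1. \<forall>p::'a imat.
     mat_subprojection p (mat_unit n) \<and> mat_mvn_equiv p (mat_unit n) \<longrightarrow> p = mat_unit n)"

text \<open>
  Traces of projections are real, so the strict order of \<open>\<complex>\<close> is the one of \<open>\<real>\<close> here.
\<close>

definition order_determined_by_traces :: "'a::cstar_algebra itself \<Rightarrow> bool" where
  "order_determined_by_traces _ \<longleftrightarrow> (\<forall>p\<in>mat_projections. \<forall>q\<in>mat_projections.
     (\<forall>\<tau>\<in>(tracial_states :: ('a \<Rightarrow> complex) set). mat_trace \<tau> p < mat_trace \<tau> q)
       \<longrightarrow> mat_precsim p q)"

section \<open>Rokhlin properties\<close>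

definition rokhlin_property :: "('a::cstar_algebra \<Rightarrow> 'a) \<Rightarrow> bool" where
  "rokhlin_property \<alpha> \<longleftrightarrow> (\<forall>F \<epsilon> n. finite F \<and> \<epsilon> > 0 \<longrightarrow>
     (\<exists>e f :: nat \<Rightarrow> 'a.
        (\<forall>j<n. projection (e j)) \<and> (\<forall>j\<le>n. projection (f j)) \<and>
        (\<forall>i<n. \<forall>j<n. i \<noteq> j \<longrightarrow> e i * e j = 0) \<and>
        (\<forall>i\<le>n. \<forall>j\<le>n. i \<noteq> j \<longrightarrow> f i * f j = 0) \<and>
        (\<forall>i<n. \<forall>j\<le>n. e i * f j = 0 \<and> f j * e i = 0) \<and>
        (\<forall>j. j + 1 < n \<longrightarrow> norm (\<alpha> (e j) - e (j + 1)) < \<epsilon>) \<and>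
        (\<forall>j<n. norm (\<alpha> (f j) - f (j + 1)) < \<epsilon>) \<and>
        (\<forall>a\<in>F. (\<forall>j<n. norm (e j * a - a * e j) < \<epsilon>) \<and>
               (\<forall>j\<le>n. norm (f j * a - a * f j) < \<epsilon>)) \<and>
        (\<Sum>j<n. e j) + (\<Sum>j\<le>n. f j) = 1))"

definition tracial_rokhlin_property :: "('a::cstar_algebra \<Rightarrow> 'a) \<Rightarrow> bool" where
  "tracial_rokhlin_property \<alpha> \<longleftrightarrow>
     (\<forall>F \<epsilon> n x. finite F \<and> \<epsilon> > 0 \<and> positive x \<and> x \<noteq> 0 \<longrightarrow>
     (\<exists>e :: nat \<Rightarrow> 'a.
        (\<forall>j\<le>n. projection (e j)) \<and>
        (\<forall>i\<le>n. \<forall>j\<le>n. i \<noteq> j \<longrightarrow> e i * e j = 0) \<and>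
        (\<forall>j<n. norm (\<alpha> (e j) - e (j + 1)) < \<epsilon>) \<and>
        (\<forall>a\<in>F. \<forall>j\<le>n. norm (e j * a - a * e j) < \<epsilon>) \<and>
        (\<exists>q\<in>hereditary_subalgebra x. projection q \<and> mvn_equiv (1 - (\<Sum>j\<le>n. e j)) q)))"

end

theory Submission
  imports Defs
begin

text \<open>
  Apply the Rokhlin property with towers of lengths \<open>N\<close> and \<open>N + 1\<close>, where \<open>N = (n + 1) m L\<close> and \<open>m\<close> is the
  order of the action on traces. Cutting the towers into blocks of length \<open>n + 1\<close> yields the wanted
  projections, and only the top \<open>f N\<close> of the longer tower is left over. Nearby projections have
  equal traces, so the traces along the tower have period \<open>m\<close>, and at least \<open>L\<close> floors have the
  trace of \<open>f N\<close>; hence \<open>\<tau> (f N) \<le> 1 / L\<close> for every \<open>\<tau>\<close>. Real rank zero gives a nonzero projection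
  \<open>q \<in> x A x\<close>, and simplicity bounds \<open>\<tau> q\<close> below uniformly in \<open>\<tau>\<close>, so for large \<open>L\<close> comparison by traces
  moves \<open>f N\<close> under \<open>q\<close>.
\<close>

section \<open>Square roots and positivity\<close>

lemma star_minus: "star (- x) = - star (x :: 'a::cstar_algebra)"
  by (metis star_scaleC scaleC_complex_of_real scaleR_minus1_left complex_cnj_complex_of_real)

lemma star_diff: "star (x - y) = star x - star (y :: 'a::cstar_algebra)"
  by (metis star_add star_minus diff_conv_add_uminus)

lemma star_zero: "star (0 :: 'a::cstar_algebra) = 0"
  by (metis star_diff diff_self)

lemma star_one: "star (1 :: 'a::cstar_algebra) = 1"
  by (metis mult.right_neutral mult.left_neutral star_mult star_star)

lemma star_scaleR: "star (r *\<^sub>R x) = r *\<^sub>R star (x :: 'a::cstar_algebra)"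
  by (metis star_scaleC scaleC_complex_of_real complex_cnj_complex_of_real)

lemmas star_simps = star_star star_add star_mult star_minus star_diff star_zero star_one star_scaleR

lemma scaleC_minus_left: "(- c) *\<^sub>C x = - (c *\<^sub>C (x :: 'a::cstar_algebra))"
  by (metis add.right_inverse neg_eq_iff_add_eq_0 scaleC_add_left scaleC_complex_of_real of_real_0
      scaleR_zero_left minus_unique)

lemma scaleC_diff_right: "c *\<^sub>C (x - y) = c *\<^sub>C x - c *\<^sub>C (y :: 'a::cstar_algebra)"
  by (metis add_diff_cancel_right' diff_add_cancel scaleC_add_right)

text \<open>The C*-identity gives one inequality for every element; applying it to both
  \<open>x\<close> and \<open>star x\<close> gives equality.\<close>

lemma norm_star: "norm (star x) = norm (x :: 'a::cstar_algebra)"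
proof -
  have le: "norm y \<le> norm (star y)" for y :: 'a
  proof (cases "y = 0")
    case False
    have "norm y * norm y = norm (star y * y)"
      by (simp add: norm_star_mult_self power2_eq_square)
    also have "\<dots> \<le> norm (star y) * norm y"
      by (rule norm_mult_ineq)
    finally show ?thesis using False by simp
  qed simp
  show ?thesis using le[of x] le[of "star x"] by (simp add: star_star)
qed

lemma norm_selfadjoint_square:
  "selfadjoint a \<Longrightarrow> norm (a * a) = (norm (a :: 'a::cstar_algebra))\<^sup>2"
  by (metis norm_star_mult_self selfadjoint_def)

lemma norm_projection_le: "projection p \<Longrightarrow> norm (p :: 'a::cstar_algebra) \<le> 1"
  by (metis mult_cancel_right2 norm_ge_zero norm_star_mult_self order.refl power2_eq_square
      projection_def zero_less_one_class.zero_le_one)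

lemma continuous_star: "continuous_on S (star :: 'a::cstar_algebra \<Rightarrow> 'a)"
  unfolding continuous_on_iff dist_norm
  by (metis star_diff norm_star)

section \<open>Inverses and square roots from fixed points\<close>

lemma neumann_inverse:
  fixes k :: "'a::cstar_algebra"
  assumes "norm k < 1"
  obtains w where "(1 - k) * w = 1" and "w * (1 - k) = 1"
proof -
  \<comment> \<open>The two one-sided inverses are fixed points of contractions with constant
    \<open>norm k\<close>; once both exist, they coincide.\<close>
  have "\<exists>!x. 1 + k * x = x"
    using assms by (intro banach_fix_type[where c = "norm k"])
      (auto simp: dist_norm norm_mult_ineq simp flip: right_diff_distrib)
  then obtain w where w: "1 + k * w = w" by blast
  have "\<exists>!x. 1 + x * k = x"
    using assms by (intro banach_fix_type[where c = "norm k"])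
      (auto simp: dist_norm mult.commute[of "norm k"] norm_mult_ineq simp flip: left_diff_distrib)
  then obtain w' where w': "1 + w' * k = w'" by blast
  have r: "(1 - k) * w = 1" using w by (simp add: left_diff_distrib diff_eq_eq)
  have l: "w' * (1 - k) = 1" using w' by (simp add: right_diff_distrib diff_eq_eq)
  have "w' = w" by (metis r l mult.assoc mult.left_neutral mult.right_neutral)
  with r l that show ?thesis by blast
qed

text \<open>Writing the root as \<open>1 - g\<close>, the equation reads \<open>g = (h + g\<^sup>2) / 2\<close>, and the right-hand side
  is a contraction of the ball of radius \<open>norm h\<close>.\<close>

lemma sqrt_one_minus:
  fixes h :: "'a::cstar_algebra"
  assumes sa: "selfadjoint h" and h: "norm h < 1"
  obtains y where "selfadjoint y" and "y * y = 1 - h" and "norm (1 - y) \<le> norm h"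
    and "\<And>z. z * h = h * z \<Longrightarrow> z * y = y * z"
proof -
  \<comment> \<open>Selfadjointness and commutation with everything that commutes with
    \<open>h\<close> are closed conditions preserved by \<open>f\<close>; built into
    \<open>S\<close>, they pass to the fixed point.\<close>
  define S where "S = {g. star g = g} \<inter> cball 0 (norm h) \<inter> (\<Inter>z\<in>{z. z * h = h * z}. {g. z * g = g * z})"
  define f where "f = (\<lambda>g. (1/2) *\<^sub>R (h + g * g))"
  have "closed S"
    unfolding S_def
    by (intro closed_Int closed_INT ballI closed_Collect_eq continuous_intros continuous_star closed_cball)
  then have "complete S" by (simp add: complete_eq_closed)
  moreover have "S \<noteq> {}"
  proof -
    have "h \<in> S" using sa by (auto simp: S_def selfadjoint_def)
    then show ?thesis by blast
  qed
  moreover have "f ` S \<subseteq> S"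
  proof (rule image_subsetI)
    fix g assume g: "g \<in> S"
    then have n: "norm g \<le> norm h" and c: "\<And>z. z * h = h * z \<Longrightarrow> z * g = g * z" and s: "star g = g"
      by (auto simp: S_def)
    have "norm (g * g) \<le> norm g * norm g" by (rule norm_mult_ineq)
    also have "\<dots> \<le> norm h * 1" using n h by (intro mult_mono) auto
    finally have "norm (h + g * g) \<le> 2 * norm h" using norm_triangle_ineq[of h "g * g"] by linarith
    then have "f g \<in> cball 0 (norm h)" by (simp add: f_def)
    moreover have "star (f g) = f g" using s sa by (simp add: f_def star_simps selfadjoint_def)
    moreover have "z * f g = f g * z" if "z * h = h * z" for z
      using that c[OF that] unfolding f_def
      by (simp add: distrib_left distrib_right) (metis mult.assoc)
    ultimately show "f g \<in> S" by (simp add: S_def)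
  qed
  moreover have "dist (f x) (f y) \<le> norm h * dist x y" if "x \<in> S" "y \<in> S" for x y
  proof -
    from that have x: "norm x \<le> norm h" and y: "norm y \<le> norm h" by (auto simp: S_def)
    have "f x - f y = (1/2) *\<^sub>R (x * (x - y) + (x - y) * y)"
      by (simp add: f_def algebra_simps)
    also have "norm \<dots> \<le> (1/2) * (norm x * norm (x - y) + norm (x - y) * norm y)"
      using norm_triangle_le[OF add_mono[OF norm_mult_ineq norm_mult_ineq]] by simp
    also have "\<dots> \<le> (1/2) * (norm h * norm (x - y) + norm (x - y) * norm h)"
      using x y by (intro mult_left_mono add_mono mult_right_mono) auto
    finally show "dist (f x) (f y) \<le> norm h * dist x y" by (simp add: dist_norm)
  qed
  ultimately have "\<exists>!g\<in>S. f g = g"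
    using h by (intro Banach_fix[where c = "norm h"]) auto
  then obtain g where gS: "g \<in> S" and fg: "f g = g" by blast
  have "2 *\<^sub>R g = h + g * g" using arg_cong[OF fg, of "\<lambda>t. 2 *\<^sub>R t"] by (simp add: f_def)
  then have gg: "g * g = g + g - h" by (simp add: scaleR_2)
  show ?thesis
  proof (rule that[of "1 - g"])
    show "selfadjoint (1 - g)" using gS by (simp add: selfadjoint_def star_simps S_def)
    show "(1 - g) * (1 - g) = 1 - h" by (simp add: algebra_simps gg)
    show "norm (1 - (1 - g)) \<le> norm h" using gS by (simp add: S_def)
    show "z * (1 - g) = (1 - g) * z" if "z * h = h * z" for z
      using gS that by (simp add: S_def algebra_simps)
  qed
qed

text \<open>The element \<open>a + \<i> b\<close> is a multiple of a unitary, with imaginary part \<open>b\<close>.\<close>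

lemma norm_le_of_squares:
  fixes a b :: "'a::cstar_algebra"
  assumes a: "selfadjoint a" and b: "selfadjoint b" and ab: "a * b = b * a"
    and K: "a * a + b * b = K *\<^sub>R 1"
  shows "(norm b)\<^sup>2 \<le> \<bar>K\<bar>"
proof -
  define u where "u = a + \<i> *\<^sub>C b"
  have su: "star u = a - \<i> *\<^sub>C b"
    using a b by (simp add: u_def star_add star_scaleC selfadjoint_def scaleC_minus_left)
  have ii: "\<i> *\<^sub>C (\<i> *\<^sub>C z) = - z" for z :: 'a
    using scaleC_complex_of_real[of "-1" z] by (simp add: scaleC_scaleC)
  have "star u * u = a * a + b * b"
    unfolding su unfolding u_def
    by (simp add: algebra_simps mult_scaleC_left mult_scaleC_right scaleC_diff_right scaleC_add_right ii ab)
  then have "(norm u)\<^sup>2 = \<bar>K\<bar>" using K by (metis norm_star_mult_self norm_scaleR norm_one mult_1_right)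
  moreover have "norm b \<le> norm u"
  proof -
    have "u - star u = 2 *\<^sub>R (\<i> *\<^sub>C b)" unfolding su unfolding u_def by (simp add: scaleR_2)
    then have "2 * norm b = norm (u - star u)" by (simp add: norm_scaleC)
    also have "\<dots> \<le> 2 * norm u" using norm_triangle_ineq4[of u "star u"] by (simp add: norm_star)
    finally show ?thesis by simp
  qed
  ultimately show ?thesis by (metis power_mono norm_ge_zero)
qed

text \<open>Scaling by \<open>1 / K\<close> reduces to \<open>sqrt_one_minus\<close>. The root
  \<open>v\<close> takes the place of the order relation \<open>h \<le> K\<close>, and its
  commutation property lets it be combined with other elements.\<close>

lemma sqrt_scalar_minus:
  fixes h :: "'a::cstar_algebra"
  assumes sa: "selfadjoint h" and h: "norm h < K"
  obtains v where "selfadjoint v" and "v * v = K *\<^sub>R 1 - h"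
    and "\<And>z. z * h = h * z \<Longrightarrow> z * v = v * z"
proof -
  have K: "K > 0" using h norm_ge_zero[of h] by linarith
  have "selfadjoint ((1/K) *\<^sub>R h)" using sa by (simp add: selfadjoint_def star_simps)
  moreover have "norm ((1/K) *\<^sub>R h) < 1" using h K by simp
  ultimately obtain y where y: "selfadjoint y" "y * y = 1 - (1/K) *\<^sub>R h"
    and c: "\<And>z. z * ((1/K) *\<^sub>R h) = (1/K) *\<^sub>R h * z \<Longrightarrow> z * y = y * z"
    using sqrt_one_minus by metis
  show ?thesis
  proof (rule that[of "sqrt K *\<^sub>R y"])
    show "selfadjoint (sqrt K *\<^sub>R y)" using y(1) by (simp add: selfadjoint_def star_simps)
    show "sqrt K *\<^sub>R y * sqrt K *\<^sub>R y = K *\<^sub>R 1 - h" using K y(2) by (simp add: scaleR_diff_right)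
    show "z * sqrt K *\<^sub>R y = sqrt K *\<^sub>R y * z" if "z * h = h * z" for z
      using c[of z] that by simp
  qed
qed

text \<open>The root \<open>v\<close> of \<open>K - w\<^sup>2\<close> commutes with
  \<open>w\<close>, and the two squares add up to \<open>K\<close>; so
  \<open>norm_le_of_squares\<close> bounds \<open>(norm v)\<^sup>2\<close>, which is the norm in
  question.\<close>

lemma norm_scalar_minus_square_le:
  fixes w :: "'a::cstar_algebra"
  assumes sa: "selfadjoint w" and K: "(norm w)\<^sup>2 < K"
  shows "norm (K *\<^sub>R 1 - w * w) \<le> K"
proof -
  have "selfadjoint (w * w)" using sa by (simp add: selfadjoint_def star_simps)
  then obtain v where v: "selfadjoint v" "v * v = K *\<^sub>R 1 - w * w"
    and c: "\<And>z. z * (w * w) = w * w * z \<Longrightarrow> z * v = v * z"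
    using sqrt_scalar_minus[of "w * w" K] K norm_selfadjoint_square[OF sa] by metis
  have "(norm v)\<^sup>2 \<le> \<bar>K\<bar>"
    using sa v c[of w] by (intro norm_le_of_squares[of w v]) (auto simp: mult.assoc)
  then show ?thesis
    using K by (metis v norm_selfadjoint_square abs_of_pos le_less_trans zero_le_power2)
qed

text \<open>For small \<open>c > 0\<close>, \<open>s\<^sup>2 - c = s (1 - c s\<^sup>-\<^sup>2) s\<close> is still a square.\<close>

lemma norm_one_minus_square_less:
  fixes s t :: "'a::cstar_algebra"
  assumes sa: "selfadjoint s" and st: "s * t = 1" "t * s = 1" and ns: "norm s < 1"
  shows "norm (1 - s * s) < 1"
proof -
  have ta: "selfadjoint t"
    unfolding selfadjoint_def
    by (metis sa st selfadjoint_def star_mult star_one mult.assoc mult.left_neutral mult.right_neutral)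
  have "((norm s)\<^sup>2) < 1" using ns by (simp add: power_less_one_iff abs_square_less_1)
  \<comment> \<open>The first bound yields \<open>(norm s)\<^sup>2 + c < 1 - c\<close>; the second
    makes the norm of \<open>c t\<^sup>2\<close> less than 1, so that \<open>1 - c t\<^sup>2\<close>
    has a root. The resulting estimate is \<open>1 - c\<close>.\<close>
  define c where "c = min ((1 - (norm s)\<^sup>2) / 3) (1 / (1 + (norm t)\<^sup>2))"
  have c0: "c > 0" using \<open>(norm s)\<^sup>2 < 1\<close> by (simp add: c_def add_pos_nonneg)
  have c1: "(norm s)\<^sup>2 + 2 * c < 1"
  proof -
    have "c \<le> (1 - (norm s)\<^sup>2) / 3" unfolding c_def by (rule min.cobounded1)
    then show ?thesis using \<open>(norm s)\<^sup>2 < 1\<close> by (simp add: field_simps)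
  qed
  have c2: "c * (norm t)\<^sup>2 < 1"
  proof -
    have "c * (1 + (norm t)\<^sup>2) \<le> 1"
      using mult_right_mono[of c "1 / (1 + (norm t)\<^sup>2)" "1 + (norm t)\<^sup>2"]
      by (simp add: c_def add_nonneg_eq_0_iff)
    then show ?thesis using c0 by (simp add: distrib_left)
  qed
  have "selfadjoint (c *\<^sub>R (t * t))" using ta by (simp add: selfadjoint_def star_simps)
  moreover have "norm (c *\<^sub>R (t * t)) < 1" using c2 c0 by (simp add: norm_selfadjoint_square[OF ta])
  ultimately obtain y where y: "selfadjoint y" "y * y = 1 - c *\<^sub>R (t * t)"
    and yc: "\<And>z. z * (c *\<^sub>R (t * t)) = c *\<^sub>R (t * t) * z \<Longrightarrow> z * y = y * z"
    using sqrt_one_minus by metis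
  have sy: "s * y = y * s"
    by (rule yc) (simp, metis st mult.assoc)
  define w where "w = s * y"
  have wa: "selfadjoint w"
    using sa y(1) sy by (simp add: w_def selfadjoint_def star_mult)
  have "w * w = s * s * (y * y)" unfolding w_def by (metis sy mult.assoc)
  also have "\<dots> = s * s - c *\<^sub>R 1"
  proof -
    have "s * s * (t * t) = 1" by (metis st(1) mult.assoc mult.right_neutral)
    then show ?thesis by (simp add: y(2) right_diff_distrib)
  qed
  finally have ww: "w * w = s * s - c *\<^sub>R 1" .
  have "(norm w)\<^sup>2 = norm (s * s - c *\<^sub>R 1)" using norm_selfadjoint_square[OF wa] ww by simp
  also have "\<dots> \<le> (norm s)\<^sup>2 + c"
    using norm_triangle_ineq4[of "s * s" "c *\<^sub>R 1"] c0 norm_selfadjoint_square[OF sa] by simp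
  also have "\<dots> < 1 - c" using c1 by simp
  finally have "norm ((1 - c) *\<^sub>R 1 - w * w) \<le> 1 - c"
    by (rule norm_scalar_minus_square_le[OF wa])
  moreover have "(1 - c) *\<^sub>R 1 - w * w = 1 - s * s" by (simp add: ww scaleR_diff_left)
  ultimately show ?thesis using c0 by simp
qed

text \<open>Here \<open>y\<close> is the absolute value of \<open>s\<close>, obtained as the root of
  \<open>1 - (1 - s\<^sup>2)\<close>, and \<open>u = y t\<close> is the sign of \<open>s\<close>.
  The bound on \<open>1 - y\<close> records that \<open>y\<close> is positive.\<close>

lemma selfadjoint_polar_decomposition:
  fixes s t :: "'a::cstar_algebra"
  assumes sa: "selfadjoint s" and st: "s * t = 1" "t * s = 1" and ns: "norm s < 1"
  obtains u y where "selfadjoint u" and "u * u = 1" and "s * u = y" and "y * u = s"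
    and "selfadjoint y" and "norm (1 - y) < 1"
proof -
  have ta: "star t = t"
    by (metis sa st selfadjoint_def star_mult star_one mult.assoc mult.left_neutral mult.right_neutral)
  have "selfadjoint (1 - s * s)" using sa by (simp add: selfadjoint_def star_simps)
  then obtain y where y: "selfadjoint y" "y * y = s * s" "norm (1 - y) < 1"
    and c: "\<And>z. z * (1 - s * s) = (1 - s * s) * z \<Longrightarrow> z * y = y * z"
    using sqrt_one_minus[of "1 - s * s"] norm_one_minus_square_less[OF sa st ns]
    by (metis diff_diff_eq2 add_diff_cancel_left' le_less_trans)
  have sy: "s * y = y * s" by (rule c) (simp add: algebra_simps)
  have ty: "t * y = y * t" by (metis sy st mult.assoc mult.left_neutral mult.right_neutral)
  define u where "u = y * t"
  have "s * u = y" unfolding u_def by (metis sy st(1) mult.assoc mult.right_neutral)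
  moreover have yu: "y * u = s"
    unfolding u_def by (metis y(2) st(1) mult.assoc mult.right_neutral)
  moreover have "u * u = 1"
    using yu st(2) ty unfolding u_def by (metis mult.assoc)
  moreover have "selfadjoint u"
    using y(1) ty ta by (simp add: u_def selfadjoint_def star_mult)
  ultimately show ?thesis using that y by blast
qed

section \<open>Projections in hereditary subalgebras\<close>

text \<open>The norm bound makes the compression of \<open>x\<^sup>2\<close> to \<open>p\<close>
  invertible in \<open>p A p\<close>. With \<open>d\<close> its inverse there, \<open>x d x\<close>
  is the range projection of \<open>x p\<close>.\<close>

lemma compressed_square_projection:
  fixes p x :: "'a::cstar_algebra"
  assumes p: "projection p" "p \<noteq> 0" and x: "selfadjoint x" and r: "r > 0"
    and k: "norm (p - r *\<^sub>R (p * x * x * p)) < 1"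
  obtains d where "projection (x * d * x)" and "x * d * x \<noteq> 0"
proof -
  define k where "k = p - r *\<^sub>R (p * x * x * p)"
  have pp: "p * p = p" and sp: "star p = p" using p by (auto simp: projection_def)
  have sx: "star x = x" using x by (simp add: selfadjoint_def)
  obtain w where w: "(1 - k) * w = 1" "w * (1 - k) = 1"
    using neumann_inverse k unfolding k_def by blast
  have pk: "p * k = k" "k * p = k"
    unfolding k_def by (simp_all add: right_diff_distrib left_diff_distrib pp mult.assoc)
      (metis pp mult.assoc)
  have sk: "star k = k" by (simp add: k_def star_simps sp sx mult.assoc)
  have sw: "star w = w"
    by (metis w sk star_diff star_mult star_one mult.assoc mult.left_neutral mult.right_neutral)
  have pw: "p * w = w * p"
  proof -
    have "(1 - k) * p = p * (1 - k)" by (simp add: algebra_simps pk)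
    then show ?thesis by (metis w mult.assoc mult.left_neutral mult.right_neutral)
  qed
  \<comment> \<open>Since \<open>p (1 - k)\<close> is \<open>r\<close> times the compression of
    \<open>x\<^sup>2\<close>, this is the inverse of that compression in the corner of
    \<open>p\<close>.\<close>
  define d where "d = r *\<^sub>R (p * w)"
  have comp: "r *\<^sub>R (p * x * x * p) = p * (1 - k)"
    by (simp add: right_diff_distrib pk) (simp add: k_def)
  have dd: "d * x * x * d = d"
  proof -
    have "d * x * x * d = r *\<^sub>R (w * (r *\<^sub>R (p * x * x * p)) * w)"
      unfolding d_def using pw by (simp add: mult.assoc)
    also have "\<dots> = r *\<^sub>R (w * p)"
      unfolding comp by (metis w(1) mult.assoc mult.right_neutral)
    finally show ?thesis by (simp add: d_def pw)
  qed
  have "x * d * x * (x * d * x) = x * (d * x * x * d) * x" by (simp add: mult.assoc)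
  moreover have "star (x * d * x) = x * d * x"
    using pw by (simp add: star_simps d_def sp sx sw mult.assoc)
  ultimately have "projection (x * d * x)" by (simp add: projection_def dd)
  moreover have "x * d * x \<noteq> 0"
  proof
    assume "x * d * x = 0"
    then have "d = 0" by (metis dd mult.assoc mult_zero_left mult_zero_right)
    then have "p * w = 0" using r by (simp add: d_def)
    then show False using p(2) w by (metis mult.assoc mult_zero_left mult.right_neutral)
  qed
  ultimately show ?thesis using that by blast
qed

text \<open>Real rank zero lets us perturb \<open>x\<^sup>2 - c\<close> to an invertible selfadjoint \<open>s\<close>; the projection \<open>p\<close> below
  is the spectral projection of \<open>s\<close> for \<open>(0, \<infinity>)\<close>, on which \<open>x\<^sup>2\<close> is bounded below.\<close>

lemma real_rank_zero_projection_normalized: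
  fixes x :: "'a::cstar_algebra"
  assumes rr: "real_rank_zero TYPE('a)" and x: "selfadjoint x" and nx: "norm x = 1/2"
  obtains d where "projection (x * d * x)" and "x * d * x \<noteq> 0"
proof -
  \<comment> \<open>Two demands fix the size of \<open>c\<close>: \<open>1/4 + 2 c < 1\<close> for
    the norm of \<open>s\<close>, and \<open>2 c < 1/4\<close> to exclude
    \<open>p = 0\<close>.\<close>
  define c :: real where "c = 1/16"
  have nh: "norm (x * x) = 1/4" by (simp add: norm_selfadjoint_square[OF x] nx power2_eq_square)
  have "selfadjoint (x * x - c *\<^sub>R 1)" using x by (simp add: selfadjoint_def star_simps)
  then have "x * x - c *\<^sub>R 1 \<in> closure {a. selfadjoint a \<and> (\<exists>b. a * b = 1 \<and> b * a = 1)}"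
    using rr by (auto simp: real_rank_zero_def)
  moreover have "c > 0" by (simp add: c_def)
  ultimately obtain s t where s: "selfadjoint s" "s * t = 1" "t * s = 1"
    and sn: "norm (s - (x * x - c *\<^sub>R 1)) < c"
    unfolding closure_approachable dist_norm by blast
  define e where "e = x * x - c *\<^sub>R 1 - s"
  have ne: "norm e < c" using sn by (simp add: e_def norm_minus_commute)
  have xx: "x * x = c *\<^sub>R 1 + s + e" by (simp add: e_def)
  have "norm s \<le> norm (x * x) + norm (c *\<^sub>R (1::'a)) + norm e"
    using norm_triangle_ineq4[of "x * x - c *\<^sub>R 1" e] norm_triangle_ineq4[of "x * x" "c *\<^sub>R 1"]
    by (simp add: e_def)
  then have "norm s < 1" using nh ne by (simp add: c_def)
  then obtain u y where u: "selfadjoint u" "u * u = 1" and su: "s * u = y" and yu: "y * u = s"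
    and y: "selfadjoint y" "norm (1 - y) < 1"
    using selfadjoint_polar_decomposition[OF s] by metis
  define p where "p = (1/2) *\<^sub>R (1 + u)"
  have p: "projection p"
    using u by (simp add: p_def projection_def selfadjoint_def star_simps algebra_simps)
      (simp flip: scaleR_add_left)
  have sp: "s * p = y * p" by (simp add: p_def algebra_simps su yu)
  \<comment> \<open>If \<open>p\<close> vanished, then \<open>s = - y\<close>, and
    \<open>2 c - x\<^sup>2\<close> would be the square of some \<open>v\<close> commuting with
    \<open>x\<close>. This forces \<open>(norm x)\<^sup>2 \<le> 2 c\<close>, against
    \<open>norm x = 1/2\<close>.\<close>
  have p0: "p \<noteq> 0"
  proof
    assume "p = 0"
    then have "u = - 1" by (simp add: p_def add_eq_0_iff2 minus_equation_iff)
    then have s: "s = - y" using yu by simp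
    define h where "h = x * x + (1 - c) *\<^sub>R 1"
    have "h = (1 - y) + e" by (simp add: h_def xx s scaleR_diff_left)
    then have "norm h < 1 + c" using norm_triangle_ineq[of "1 - y" e] y ne by simp
    moreover have "selfadjoint h" using x by (simp add: h_def selfadjoint_def star_simps)
    ultimately obtain v where v: "selfadjoint v" "v * v = (1 + c) *\<^sub>R 1 - h"
      and vc: "\<And>z. z * h = h * z \<Longrightarrow> z * v = v * z"
      using sqrt_scalar_minus by metis
    have "x * v = v * x" by (rule vc) (simp add: h_def algebra_simps)
    moreover have "v * v + x * x = (2 * c) *\<^sub>R 1"
      by (simp add: v h_def algebra_simps) (simp flip: scaleR_add_left)
    ultimately have "(norm x)\<^sup>2 \<le> \<bar>2 * c\<bar>"
      using v x by (intro norm_le_of_squares[of v x]) auto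
    then show False by (simp add: nx c_def power2_eq_square)
  qed
  \<comment> \<open>The compression of \<open>x\<^sup>2\<close> differs from
    \<open>(1 + c) p\<close> by an element of norm below \<open>1 + c\<close>, so this scaling
    brings it within distance 1 of \<open>p\<close>.\<close>
  define r where "r = 1 / (1 + c)"
  have pp: "p * p = p" using p by (simp add: projection_def)
  have "p * x * x * p = p * (x * x) * p" by (simp add: mult.assoc)
  also have "\<dots> = p * (c *\<^sub>R 1 + y + e) * p"
    unfolding xx by (simp add: algebra_simps sp)
  finally have pxp: "p * x * x * p = (1 + c) *\<^sub>R p - p * ((1 - y) - e) * p"
    by (simp add: algebra_simps pp)
  have "p - r *\<^sub>R (p * x * x * p) = r *\<^sub>R (p * ((1 - y) - e) * p)"
    unfolding pxp by (simp add: r_def scaleR_diff_right c_def)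
  also have "norm \<dots> = r * norm (p * ((1 - y) - e) * p)" by (simp add: r_def c_def)
  also have "\<dots> \<le> r * norm ((1 - y) - e)"
  proof (rule mult_left_mono)
    have "norm (p * ((1 - y) - e) * p) \<le> norm (p * ((1 - y) - e)) * norm p" by (rule norm_mult_ineq)
    also have "\<dots> \<le> norm (p * ((1 - y) - e)) * 1"
      by (intro mult_left_mono norm_projection_le p) auto
    also have "\<dots> \<le> norm p * norm ((1 - y) - e)" by (simp add: norm_mult_ineq)
    also have "\<dots> \<le> 1 * norm ((1 - y) - e)"
      by (intro mult_right_mono norm_projection_le p) auto
    finally show "norm (p * ((1 - y) - e) * p) \<le> norm ((1 - y) - e)" by simp
  qed (simp add: r_def c_def)
  also have "\<dots> < r * (1 + c)"
    using norm_triangle_ineq4[of "1 - y" e] y(2) ne by (intro mult_strict_left_mono) (auto simp: r_def c_def)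
  also have "\<dots> = 1" by (simp add: r_def c_def)
  finally have "norm (p - r *\<^sub>R (p * x * x * p)) < 1" .
  moreover have "r > 0" by (simp add: r_def c_def)
  ultimately show ?thesis using compressed_square_projection[OF p p0 x] that by metis
qed

text \<open>Scaling reduces to norm \<open>1/2\<close>; the square of the factor is absorbed into
  \<open>d\<close>.\<close>

lemma real_rank_zero_projection:
  fixes x :: "'a::cstar_algebra"
  assumes rr: "real_rank_zero TYPE('a)" and x: "selfadjoint x" "x \<noteq> 0"
  obtains d where "projection (x * d * x)" and "x * d * x \<noteq> 0"
proof -
  define r where "r = 1 / (2 * norm x)"
  have "selfadjoint (r *\<^sub>R x)" using x by (simp add: selfadjoint_def star_simps)
  moreover have "norm (r *\<^sub>R x) = 1/2" using x by (simp add: r_def)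
  ultimately obtain d where "projection (r *\<^sub>R x * d * r *\<^sub>R x)" "r *\<^sub>R x * d * r *\<^sub>R x \<noteq> 0"
    using real_rank_zero_projection_normalized[OF rr] by metis
  then show ?thesis using that[of "(r * r) *\<^sub>R d"] by simp
qed

section \<open>Traces of projections\<close>

lemma
  fixes \<tau> :: "'a::cstar_algebra \<Rightarrow> complex"
  assumes "\<tau> \<in> tracial_states"
  shows tracial_state_add: "\<tau> (x + y) = \<tau> x + \<tau> y"
    and tracial_state_scaleC: "\<tau> (c *\<^sub>C x) = c * \<tau> x"
    and tracial_state_positive: "0 \<le> \<tau> (star x * x)"
    and tracial_state_one: "\<tau> 1 = 1"
    and tracial_state_commute: "\<tau> (x * y) = \<tau> (y * x)"
  using assms by (auto simp: tracial_states_def)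

lemma tracial_state_scaleR: "\<tau> \<in> tracial_states \<Longrightarrow> \<tau> (r *\<^sub>R x) = of_real r * \<tau> x"
  by (metis tracial_state_scaleC scaleC_complex_of_real)

lemma tracial_state_diff: "\<tau> \<in> tracial_states \<Longrightarrow> \<tau> (x - y) = \<tau> x - \<tau> y"
  by (metis tracial_state_add add_diff_cancel_right' diff_add_cancel)

lemma tracial_state_zero: "\<tau> \<in> tracial_states \<Longrightarrow> \<tau> 0 = 0"
  by (metis tracial_state_diff diff_self)

lemma tracial_state_sum: "\<tau> \<in> tracial_states \<Longrightarrow> \<tau> (sum f I) = (\<Sum>i\<in>I. \<tau> (f i))"
  by (induction I rule: infinite_finite_induct) (auto simp: tracial_state_zero tracial_state_add)

lemma tracial_state_projection:
  assumes "\<tau> \<in> tracial_states" and "projection p"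
  shows "0 \<le> Re (\<tau> p)" and "Im (\<tau> p) = 0"
  using tracial_state_positive[OF assms(1), of p] assms(2)
  by (auto simp: projection_def less_eq_complex_def)

text \<open>If \<open>K - b = v\<^sup>2\<close>, positivity of the trace of
  \<open>q v\<^sup>2 q\<close> bounds that of \<open>b q\<close>; take \<open>b\<close> to be
  \<open>c\<close> and \<open>- c\<close>. The added 1 supplies the strict inequality required by
  \<open>sqrt_scalar_minus\<close>.\<close>

lemma tracial_state_compression_selfadjoint:
  assumes \<tau>: "\<tau> \<in> tracial_states" and q: "projection q" and c: "selfadjoint (c :: 'a::cstar_algebra)"
  shows "cmod (\<tau> (c * q)) \<le> (norm c + 1) * Re (\<tau> q)"
proof -
  have qq: "q * q = q" "star q = q" using q by (auto simp: projection_def)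
  have le: "Re (\<tau> (b * q)) \<le> (norm b + 1) * Re (\<tau> q) \<and> Im (\<tau> (b * q)) = 0"
    if b: "selfadjoint b" for b
  proof -
    have "norm b < norm b + 1" by simp
    from sqrt_scalar_minus[OF b this]
    obtain v where v: "selfadjoint v" "v * v = (norm b + 1) *\<^sub>R 1 - b" by blast
    have "\<tau> (star (v * q) * (v * q)) = \<tau> (q * ((v * v) * q))"
      using v(1) by (simp add: star_mult selfadjoint_def qq mult.assoc)
    also have "\<dots> = \<tau> ((v * v) * q)"
      by (metis tracial_state_commute[OF \<tau>] qq(1) mult.assoc)
    also have "\<dots> = of_real (norm b + 1) * \<tau> q - \<tau> (b * q)"
      by (simp add: v(2) left_diff_distrib tracial_state_diff[OF \<tau>] tracial_state_scaleR[OF \<tau>])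
    finally show ?thesis
      using tracial_state_positive[OF \<tau>, of "v * q"] tracial_state_projection[OF \<tau> q]
      by (simp add: less_eq_complex_def)
  qed
  have "\<tau> ((- c) * q) = - \<tau> (c * q)"
    using tracial_state_diff[OF \<tau>, of 0 "c * q"] by (simp add: tracial_state_zero[OF \<tau>])
  moreover have "selfadjoint (- c)" using c by (simp add: selfadjoint_def star_minus)
  ultimately have "\<bar>Re (\<tau> (c * q))\<bar> \<le> (norm c + 1) * Re (\<tau> q)"
    using le[OF c] le[of "- c"] by (simp add: abs_le_iff)
  then show ?thesis using le[OF c] by (simp add: cmod_eq_Re)
qed

text \<open>Splitting \<open>w\<close> into real and imaginary parts reduces to selfadjoint
  elements. The point is that \<open>K\<close> is independent of \<open>\<tau>\<close>.\<close>

lemma tracial_state_compression_bound: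
  fixes q w :: "'a::cstar_algebra"
  assumes q: "projection q"
  obtains K where "\<And>\<tau>. \<tau> \<in> tracial_states \<Longrightarrow> cmod (\<tau> (w * q)) \<le> K * Re (\<tau> q)"
proof -
  define a where "a = (1/2) *\<^sub>R (w + star w)"
  define b where "b = (- \<i> / 2) *\<^sub>C (w - star w)"
  have a: "selfadjoint a" by (simp add: a_def selfadjoint_def star_simps add.commute)
  have b: "selfadjoint b"
    by (simp add: b_def selfadjoint_def star_scaleC star_diff star_star scaleC_diff_right
        scaleC_minus_left)
  have ib: "\<i> *\<^sub>C b = (1/2) *\<^sub>R (w - star w)"
    using scaleC_complex_of_real[of "1/2"] by (simp add: b_def scaleC_scaleC)
  have w: "w = a + \<i> *\<^sub>C b"
    by (simp add: ib a_def algebra_simps) (simp flip: scaleR_add_left)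
  have "cmod (\<tau> (w * q)) \<le> (norm a + 1 + (norm b + 1)) * Re (\<tau> q)" if \<tau>: "\<tau> \<in> tracial_states" for \<tau>
  proof -
    have "\<tau> (w * q) = \<tau> (a * q) + \<i> * \<tau> (b * q)"
      by (subst w) (simp add: distrib_right mult_scaleC_left tracial_state_add[OF \<tau>]
          tracial_state_scaleC[OF \<tau>])
    also have "cmod \<dots> \<le> cmod (\<tau> (a * q)) + cmod (\<tau> (b * q))"
      using norm_triangle_ineq[of "\<tau> (a * q)" "\<i> * \<tau> (b * q)"] by (simp add: norm_mult)
    finally show ?thesis
      using tracial_state_compression_selfadjoint[OF \<tau> q a]
        tracial_state_compression_selfadjoint[OF \<tau> q b] by (simp add: distrib_right)
  qed
  then show ?thesis by (rule that)
qed

section \<open>A uniform lower bound for the traces of a nonzero projection\<close>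

lemma closed_ideal_closure:
  fixes J :: "'a::cstar_algebra set"
  assumes 0: "0 \<in> J" and add: "\<And>a b. a \<in> J \<Longrightarrow> b \<in> J \<Longrightarrow> a + b \<in> J"
    and scale: "\<And>c a. a \<in> J \<Longrightarrow> c *\<^sub>C a \<in> J"
    and mult: "\<And>x a. a \<in> J \<Longrightarrow> x * a \<in> J \<and> a * x \<in> J"
  shows "closed_ideal (closure J)"
proof -
  have cl: "f a \<in> closure J" if "a \<in> closure J" "continuous_on UNIV f" "\<And>b. b \<in> J \<Longrightarrow> f b \<in> J"
    for f :: "'a \<Rightarrow> 'a" and a
  proof -
    have "f ` closure J \<subseteq> closure J"
    proof (rule image_closure_subset)
      show "continuous_on (closure J) f" using that(2) by (rule continuous_on_subset) simp
      show "f ` J \<subseteq> closure J" using that(3) closure_subset[of J] by blast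
    qed simp
    then show ?thesis using that(1) by blast
  qed
  have "a + b \<in> closure J" if "a \<in> closure J" "b \<in> closure J" for a b
  proof -
    have "(a, b) \<in> closure (J \<times> J)" using that by (simp add: closure_Times)
    moreover have "(\<lambda>z. fst z + snd z) ` closure (J \<times> J) \<subseteq> closure J"
    proof (rule image_closure_subset)
      show "(\<lambda>z. fst z + snd z) ` (J \<times> J) \<subseteq> closure J" using add closure_subset[of J] by auto
    qed (auto intro!: continuous_intros)
    ultimately have "(\<lambda>z. fst z + snd z) (a, b) \<in> closure J" by blast
    then show ?thesis by simp
  qed
  moreover have "c *\<^sub>C a \<in> closure J" if "a \<in> closure J" for c a
  proof (rule cl[OF that])
    show "continuous_on UNIV (\<lambda>a. c *\<^sub>C (a :: 'a))"
    proof -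
      \<comment> \<open>Multiplication by a scalar is multiplication by
        \<open>c *\<^sub>C 1\<close>, hence continuous.\<close>
      have "continuous_on UNIV (\<lambda>a :: 'a. (c *\<^sub>C 1) * a)" by (intro continuous_intros)
      then show ?thesis by (simp add: mult_scaleC_left)
    qed
  qed (rule scale)
  moreover have "x * a \<in> closure J \<and> a * x \<in> closure J" if "a \<in> closure J" for x a
    using mult by (intro conjI cl[OF that] continuous_intros) auto
  ultimately show ?thesis
    using 0 closure_subset[of J] by (auto simp: closed_ideal_def)
qed

text \<open>The elements \<open>z\<close> for which every \<open>\<tau> (w z)\<close> is bounded by a multiple of \<open>\<tau> q\<close> form an ideal
  containing \<open>q\<close>; by simplicity it contains an invertible element.\<close>

lemma simple_trace_lower_bound:
  fixes q :: "'a::cstar_algebra"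
  assumes simple: "simple_cstar TYPE('a)" and q: "projection q" "q \<noteq> 0"
  obtains K where "\<And>\<tau>. \<tau> \<in> tracial_states \<Longrightarrow> 1 \<le> K * Re (\<tau> q)"
proof -
  \<comment> \<open>Quantifying over \<open>w\<close> makes \<open>J\<close> stable under left
    multiplication, and the trace property then gives right multiplication. The bound
    \<open>K\<close> may depend on \<open>w\<close> and \<open>z\<close>, never on
    \<open>\<tau>\<close>.\<close>
  define J where "J = {z. \<forall>w. \<exists>K. \<forall>\<tau>\<in>tracial_states. cmod (\<tau> (w * z)) \<le> K * Re (\<tau> q)}"
  have "closed_ideal (closure J)"
  proof (rule closed_ideal_closure)
    show "0 \<in> J" by (auto simp: J_def tracial_state_zero intro!: exI[of _ 0])
  next
    fix a b assume "a \<in> J" "b \<in> J"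
    show "a + b \<in> J"
      unfolding J_def
    proof (intro CollectI allI)
      fix w
      obtain K L where "\<forall>\<tau>\<in>tracial_states. cmod (\<tau> (w * a)) \<le> K * Re (\<tau> q)"
        "\<forall>\<tau>\<in>tracial_states. cmod (\<tau> (w * b)) \<le> L * Re (\<tau> q)"
        using \<open>a \<in> J\<close> \<open>b \<in> J\<close> unfolding J_def by blast
      then have "\<forall>\<tau>\<in>tracial_states. cmod (\<tau> (w * (a + b))) \<le> (K + L) * Re (\<tau> q)"
        by (auto simp: distrib_left distrib_right tracial_state_add intro!: norm_triangle_mono)
      then show "\<exists>K. \<forall>\<tau>\<in>tracial_states. cmod (\<tau> (w * (a + b))) \<le> K * Re (\<tau> q)" by blast
    qed
  next
    fix c a assume "a \<in> J"
    moreover have "w * c *\<^sub>C a = (c *\<^sub>C w) * a" for w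
      by (simp add: mult_scaleC_left mult_scaleC_right)
    ultimately show "c *\<^sub>C a \<in> J" unfolding J_def by simp
  next
    fix x a assume a: "a \<in> J"
    have "cmod (\<tau> (w * (a * x))) = cmod (\<tau> ((x * w) * a))" if "\<tau> \<in> tracial_states" for \<tau> w
      using tracial_state_commute[OF that, of "w * a" x] by (simp add: mult.assoc)
    then have "a * x \<in> J" using a unfolding J_def by simp
    moreover have "x * a \<in> J" using a unfolding J_def by (simp flip: mult.assoc)
    ultimately show "x * a \<in> J \<and> a * x \<in> J" by blast
  qed
  moreover have "q \<in> J"
    unfolding J_def
  proof (intro CollectI allI)
    fix w
    obtain K where "\<And>\<tau>. \<tau> \<in> tracial_states \<Longrightarrow> cmod (\<tau> (w * q)) \<le> K * Re (\<tau> q)"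
      using tracial_state_compression_bound[OF q(1), of w] by blast
    then show "\<exists>K. \<forall>\<tau>\<in>tracial_states. cmod (\<tau> (w * q)) \<le> K * Re (\<tau> q)" by blast
  qed
  ultimately have "closure J = UNIV"
    using simple q(2) closure_subset[of J] unfolding simple_cstar_def by blast
  then have "1 \<in> closure J" by simp
  \<comment> \<open>An element of \<open>J\<close> at distance below 1 from the unit has an inverse
    \<open>w\<close>; the bound for this \<open>w\<close> bounds the trace of 1.\<close>
  then obtain j where j: "j \<in> J" "norm (1 - j) < 1"
    unfolding closure_approachable dist_norm by (metis norm_minus_commute zero_less_one)
  obtain w where "w * j = 1"
    using neumann_inverse[OF j(2)] by auto
  moreover obtain K where "\<forall>\<tau>\<in>tracial_states. cmod (\<tau> (w * j)) \<le> K * Re (\<tau> q)"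
    using j(1) unfolding J_def by blast
  ultimately have "1 \<le> K * Re (\<tau> q)" if "\<tau> \<in> tracial_states" for \<tau>
    using that tracial_state_one[OF that] by (metis norm_one)
  then show ?thesis by (rule that)
qed

text \<open>In the proof, \<open>1 - k = q p + (1 - q)(1 - p)\<close> is close to \<open>1\<close> and intertwines \<open>p\<close> and \<open>q\<close>.\<close>

lemma tracial_state_close_projections:
  assumes \<tau>: "\<tau> \<in> tracial_states" and p: "projection p" and q: "projection (q :: 'a::cstar_algebra)"
    and pq: "norm (p - q) < 1/2"
  shows "\<tau> p = \<tau> q"
proof -
  have pp: "p * p = p" and qq: "q * q = q" using p q by (auto simp: projection_def)
  \<comment> \<open>In this form \<open>norm k\<close> is visibly at most twice
    \<open>norm (p - q)\<close>, which explains the \<open>1/2\<close>.\<close>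
  define k where "k = q * (q - p) + (p - q) * p"
  have "norm k \<le> norm q * norm (q - p) + norm (p - q) * norm p"
    unfolding k_def by (intro norm_triangle_le add_mono norm_mult_ineq)
  also have "\<dots> \<le> 1 * norm (p - q) + norm (p - q) * 1"
    unfolding norm_minus_commute[of q p]
    by (intro add_mono mult_right_mono mult_left_mono norm_projection_le p q) auto
  finally have "norm k < 1" using pq by simp
  then obtain w where w: "(1 - k) * w = 1" "w * (1 - k) = 1" by (rule neumann_inverse)
  have "q * (1 - k) = (1 - k) * p"
    by (simp add: k_def algebra_simps pp qq) (simp add: pp qq flip: mult.assoc)
  \<comment> \<open>Thus \<open>q\<close> is similar to \<open>p\<close>, and traces are invariant
    under similarity.\<close>
  then have "q = (1 - k) * (p * w)" by (metis w(1) mult.assoc mult.right_neutral)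
  then have "\<tau> q = \<tau> (p * (w * (1 - k)))"
    by (metis tracial_state_commute[OF \<tau>] mult.assoc)
  then show ?thesis using w(2) by simp
qed

section \<open>Comparison of projections in corner matrices\<close>

definition corner :: "'a::cstar_algebra \<Rightarrow> 'a imat" where
  "corner a = (\<lambda>i j. if i = 0 \<and> j = 0 then a else 0)"

lemma mat_mult_corner_left: "mat_mult (corner a) b i j = (if i = 0 then a * b 0 j else 0)"
proof -
  have "{k. corner a i k \<noteq> 0} = (if i = 0 \<and> a \<noteq> 0 then {0} else {})" by (auto simp: corner_def)
  then show ?thesis by (simp add: mat_mult_def) (simp add: corner_def)
qed

text \<open>The index set in \<open>mat_mult\<close> depends on the left factor; a common finite
  range allows sums to be interchanged later.\<close>

lemma mat_mult_finite:
  assumes "finite S" and "\<And>k. k \<notin> S \<Longrightarrow> a i k = 0"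
  shows "mat_mult a b i j = (\<Sum>k\<in>S. a i k * b k j)"
  unfolding mat_mult_def using assms by (intro sum.mono_neutral_left) auto

lemma mat_inf_bound:
  assumes "v \<in> mat_inf"
  obtains n where "\<And>i j. i \<ge> n \<or> j \<ge> n \<Longrightarrow> v i j = 0"
  using assms that by (auto simp: mat_inf_def mat_n_def)

lemma mat_mult_corner_right:
  "a \<in> mat_inf \<Longrightarrow> mat_mult a (corner b) i j = (if j = 0 then a i 0 * b else 0)"
proof -
  assume "a \<in> mat_inf"
  then obtain n where n: "\<And>i j. i \<ge> n \<or> j \<ge> n \<Longrightarrow> a i j = 0" using mat_inf_bound by blast
  have "mat_mult a (corner b) i j = (\<Sum>k<Suc n. a i k * corner b k j)"
    using n by (intro mat_mult_finite) auto
  also have "\<dots> = (if j = 0 then a i 0 * b else 0)"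
    by (subst sum.lessThan_Suc_shift) (simp add: corner_def)
  finally show ?thesis .
qed

lemma corner_mat_inf: "corner a \<in> mat_inf"
  by (auto simp: mat_inf_def mat_n_def corner_def intro!: bexI[of _ 1])

lemma mat_trace_corner: "\<tau> \<in> tracial_states \<Longrightarrow> mat_trace \<tau> (corner a) = \<tau> a"
proof -
  assume "\<tau> \<in> tracial_states"
  moreover have "{i. corner a i i \<noteq> 0} = (if a \<noteq> 0 then {0} else {})" by (auto simp: corner_def)
  ultimately show ?thesis by (simp add: mat_trace_def tracial_state_zero) (simp add: corner_def)
qed

lemma corner_projection: "projection p \<Longrightarrow> corner p \<in> mat_projections"
  unfolding mat_projections_def projection_def
  by (auto simp: corner_mat_inf mat_star_def fun_eq_iff mat_mult_corner_left)
    (auto simp: corner_def star_zero)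

text \<open>Replacing the matrix \<open>v\<close> that implements the equivalence by the corner entry of \<open>r v p\<close> moves the
  equivalence into the algebra.\<close>

lemma mat_precsim_corner:
  fixes p q :: "'a::cstar_algebra"
  assumes p: "projection p" and "mat_precsim (corner p) (corner q)"
  obtains r where "projection r" and "r * q = r" and "q * r = r" and "mvn_equiv p r"
proof -
  obtain R v where R: "R \<in> mat_projections" and Rq: "mat_mult R (corner q) = R"
    and qR: "mat_mult (corner q) R = R" and v: "v \<in> mat_inf"
    and vv: "mat_mult (mat_star v) v = corner p" and vv': "mat_mult v (mat_star v) = R"
    using assms(2) by (auto simp: mat_precsim_def mat_subprojection_def mat_mvn_equiv_def)
  define r where "r = R 0 0"
  have R_inf: "R \<in> mat_inf" using R by (simp add: mat_projections_def)
  \<comment> \<open>Absorbing \<open>corner q\<close> on the left kills all rows of \<open>R\<close>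
    but the first, and on the right all columns but the first.\<close>
  have Rr: "R = corner r"
  proof (intro ext)
    fix i j
    show "R i j = corner r i j"
      using fun_cong[OF fun_cong[OF qR, of i], of j] fun_cong[OF fun_cong[OF Rq, of i], of j]
      unfolding mat_mult_corner_left mat_mult_corner_right[OF R_inf]
      by (auto simp: corner_def r_def split: if_splits)
  qed
  have star_r: "star r = r"
    using R by (auto simp: mat_projections_def mat_star_def r_def fun_eq_iff)
  have "mat_mult R R 0 0 = r" using R by (simp add: mat_projections_def r_def)
  then have rr: "r * r = r" unfolding Rr by (simp add: mat_mult_corner_left) (simp add: corner_def)
  have qr: "q * r = r" using fun_cong[OF fun_cong[OF qR, of 0], of 0] by (simp add: mat_mult_corner_left r_def)
  have rq: "r * q = r"
    using fun_cong[OF fun_cong[OF Rq, of 0], of 0] by (simp add: mat_mult_corner_right[OF R_inf] r_def)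
  have pp: "p * p = p" and sp: "star p = p" using p by (auto simp: projection_def)
  obtain n where n: "\<And>i j. i \<ge> n \<or> j \<ge> n \<Longrightarrow> v i j = 0" using mat_inf_bound[OF v] by blast
  have svv: "(\<Sum>k<n. star (v k i) * v k j) = corner p i j" for i j
    using fun_cong[OF fun_cong[OF vv, of i], of j] n
    by (subst (asm) mat_mult_finite[where S = "{..<n}"]) (auto simp: mat_star_def star_zero)
  have vsv: "(\<Sum>k<n. v i k * star (v j k)) = corner r i j" for i j
    using fun_cong[OF fun_cong[OF vv', of i], of j] n Rr
    by (subst (asm) mat_mult_finite[where S = "{..<n}"]) (auto simp: mat_star_def)
  define c where "c = v 0 0"
  \<comment> \<open>The sums below need index 0 in their range; for \<open>n = 0\<close> everything
    vanishes.\<close>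
  have n0: "v i j = 0" if "n = 0" for i j using n that by simp
  have crc: "star c * r * c = p"
  proof (cases "n = 0")
    case True
    then have "p = 0" using svv[of 0 0] by (simp add: corner_def)
    then show ?thesis using n0[OF True] by (simp add: c_def)
  next
    case False
    \<comment> \<open>This is the first entry of \<open>(v* v)(v* v) = v* R v\<close>; as
      \<open>R\<close> is a corner, only the term with \<open>c\<close> survives.\<close>
    have "p = (\<Sum>k<n. if k = 0 then p else 0)" using False by simp
    also have "\<dots> = (\<Sum>k<n. corner p 0 k * corner p k 0)"
      by (intro sum.cong) (auto simp: corner_def pp)
    also have "\<dots> = (\<Sum>k<n. (\<Sum>i<n. star (v i 0) * v i k) * (\<Sum>j<n. star (v j k) * v j 0))"
      by (simp add: svv)
    also have "\<dots> = (\<Sum>k<n. \<Sum>i<n. \<Sum>j<n. star (v i 0) * (v i k * star (v j k)) * v j 0)"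
      by (simp add: sum_product mult.assoc)
    also have "\<dots> = (\<Sum>i<n. \<Sum>j<n. \<Sum>k<n. star (v i 0) * (v i k * star (v j k)) * v j 0)"
      by (subst sum.swap, rule sum.cong[OF refl], subst sum.swap, rule refl)
    also have "\<dots> = (\<Sum>i<n. \<Sum>j<n. star (v i 0) * corner r i j * v j 0)"
      by (simp add: vsv flip: sum_distrib_left sum_distrib_right)
    also have "\<dots> = (\<Sum>i<n. \<Sum>j<n. if i = 0 then if j = 0 then star c * r * c else 0 else 0)"
      by (intro sum.cong) (auto simp: corner_def c_def)
    also have "\<dots> = star c * r * c" using False by (simp add: sum.If_cases)
    finally show ?thesis by simp
  qed
  have cpc: "c * p * star c = r"
  proof (cases "n = 0")
    case True
    then have "r = 0" using vsv[of 0 0] by (simp add: corner_def)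
    then show ?thesis using n0[OF True] by (simp add: c_def)
  next
    case False
    have "r = (\<Sum>k<n. if k = 0 then r else 0)" using False by simp
    also have "\<dots> = (\<Sum>k<n. corner r 0 k * corner r k 0)"
      by (intro sum.cong) (auto simp: corner_def rr)
    also have "\<dots> = (\<Sum>k<n. (\<Sum>i<n. v 0 i * star (v k i)) * (\<Sum>j<n. v k j * star (v 0 j)))"
      by (simp add: vsv)
    also have "\<dots> = (\<Sum>k<n. \<Sum>i<n. \<Sum>j<n. v 0 i * (star (v k i) * v k j) * star (v 0 j))"
      by (simp add: sum_product mult.assoc)
    also have "\<dots> = (\<Sum>i<n. \<Sum>j<n. \<Sum>k<n. v 0 i * (star (v k i) * v k j) * star (v 0 j))"
      by (subst sum.swap, rule sum.cong[OF refl], subst sum.swap, rule refl)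
    also have "\<dots> = (\<Sum>i<n. \<Sum>j<n. v 0 i * corner p i j * star (v 0 j))"
      by (simp add: svv flip: sum_distrib_left sum_distrib_right)
    also have "\<dots> = (\<Sum>i<n. \<Sum>j<n. if i = 0 then if j = 0 then c * p * star c else 0 else 0)"
      by (intro sum.cong) (auto simp: corner_def c_def)
    also have "\<dots> = c * p * star c" using False by (simp add: sum.If_cases)
    finally show ?thesis by simp
  qed
  define u where "u = r * c * p"
  have "star u * u = p * (star c * (r * r) * c) * p"
    by (simp add: u_def star_mult star_r sp mult.assoc)
  then have "star u * u = p" by (simp add: rr crc pp)
  moreover have "u * star u = r * (c * (p * p) * star c) * r"
    by (simp add: u_def star_mult star_r sp mult.assoc)
  then have "u * star u = r" by (simp add: pp cpc rr)
  ultimately have "mvn_equiv p r" unfolding mvn_equiv_def by blast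
  with that rr star_r rq qr show ?thesis by (simp add: projection_def)
qed

text \<open>The corner embedding preserves traces, so comparison in matrices applies, and the
  resulting subequivalence descends to the algebra.\<close>

lemma trace_comparison:
  fixes p q :: "'a::cstar_algebra"
  assumes ord: "order_determined_by_traces TYPE('a)" and p: "projection p" and q: "projection q"
    and less: "\<And>\<tau>. \<tau> \<in> tracial_states \<Longrightarrow> \<tau> p < \<tau> q"
  obtains r where "projection r" and "r * q = r" and "q * r = r" and "mvn_equiv p r"
proof -
  have "mat_precsim (corner p) (corner q)"
    using ord less corner_projection[OF p] corner_projection[OF q]
    unfolding order_determined_by_traces_def by (simp add: mat_trace_corner)
  from mat_precsim_corner[OF p this] that show ?thesis by blast
qed

section \<open>Rokhlin towers\<close>

lemma star_automorphism_diff: "star_automorphism \<alpha> \<Longrightarrow> \<alpha> (x - y) = \<alpha> x - \<alpha> y"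
  by (metis star_automorphism_def add_diff_cancel_right' diff_add_cancel)

lemma star_automorphism_sum: "star_automorphism \<alpha> \<Longrightarrow> \<alpha> (sum f I) = (\<Sum>i\<in>I. \<alpha> (f i))"
proof (induction I rule: infinite_finite_induct)
  case (insert i I)
  then show ?case by (simp add: star_automorphism_def)
qed (use star_automorphism_diff[of \<alpha> 0 0] in auto)

lemma star_automorphism_projection:
  "star_automorphism \<alpha> \<Longrightarrow> projection p \<Longrightarrow> projection (\<alpha> p)"
  unfolding star_automorphism_def projection_def by metis

lemma star_sum: "star (sum f I) = (\<Sum>i\<in>I. star (f i :: 'a::cstar_algebra))"
  by (induction I rule: infinite_finite_induct) (auto simp: star_add star_zero)

lemma orthogonal_sums:
  fixes g :: "'i \<Rightarrow> 'a::cstar_algebra"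
  assumes "\<And>i j. i \<in> I \<Longrightarrow> j \<in> J \<Longrightarrow> g i * g j = 0"
  shows "sum g I * sum g J = 0"
  using assms by (simp add: sum_product)

lemma projection_sum:
  fixes g :: "'i \<Rightarrow> 'a::cstar_algebra"
  assumes I: "finite I" and p: "\<And>i. i \<in> I \<Longrightarrow> projection (g i)"
    and orth: "\<And>i j. i \<in> I \<Longrightarrow> j \<in> I \<Longrightarrow> i \<noteq> j \<Longrightarrow> g i * g j = 0"
  shows "projection (sum g I)"
proof -
  have "sum g I * sum g I = (\<Sum>i\<in>I. \<Sum>j\<in>I. g i * g j)" by (rule sum_product)
  also have "\<dots> = (\<Sum>i\<in>I. \<Sum>j\<in>I. if j = i then g i else 0)"
    using p orth by (intro sum.cong) (auto simp: projection_def)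
  also have "\<dots> = sum g I" using I by simp
  finally show ?thesis using p by (simp add: projection_def star_sum)
qed

text \<open>Traces agree on the close projections \<open>\<alpha> (f j)\<close> and
  \<open>f (j + 1)\<close>, so climbing one floor amounts to replacing \<open>\<tau>\<close> by its
  composition with \<open>\<alpha>\<close>.\<close>

lemma tracial_state_tower:
  fixes f :: "nat \<Rightarrow> 'a::cstar_algebra"
  assumes \<alpha>: "star_automorphism \<alpha>" and f: "\<And>j. j \<le> N \<Longrightarrow> projection (f j)"
    and shift: "\<And>j. j < N \<Longrightarrow> norm (\<alpha> (f j) - f (j + 1)) < 1/2"
    and \<tau>: "\<tau> \<in> tracial_states" and le: "j + k \<le> N"
  shows "(trace_map \<alpha> ^^ k) \<tau> \<in> tracial_states \<and> \<tau> (f (j + k)) = (trace_map \<alpha> ^^ k) \<tau> (f j)"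
  using le
proof (induction k arbitrary: j)
  case (Suc k)
  define \<sigma> where "\<sigma> = (trace_map \<alpha> ^^ k) \<tau>"
  have \<sigma>: "\<sigma> \<in> tracial_states" and eq: "\<tau> (f (Suc j + k)) = \<sigma> (f (Suc j))"
    using Suc.IH[of "Suc j"] Suc.prems by (auto simp: \<sigma>_def)
  have "\<sigma> (\<alpha> (f j)) = \<sigma> (f (j + 1))"
    using Suc.prems shift f
    by (intro tracial_state_close_projections[OF \<sigma>] star_automorphism_projection[OF \<alpha>]) auto
  then show ?case
    using eq trace_map_tracial_states[OF \<alpha> \<sigma>] by (simp add: \<sigma>_def) (simp add: trace_map_def)
qed (use \<tau> in simp)

text \<open>The floors at multiples of \<open>m\<close> all have the trace of \<open>f 0\<close>,
  and so does the top because \<open>m\<close> divides \<open>N\<close>. The floors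
  \<open>m * k\<close> with \<open>k < L\<close> are distinct, and the remaining ones contribute
  nonnegative terms.\<close>

lemma tracial_state_tower_top_le:
  fixes f :: "nat \<Rightarrow> 'a::cstar_algebra"
  assumes \<alpha>: "star_automorphism \<alpha>" and f: "\<And>j. j \<le> N \<Longrightarrow> projection (f j)"
    and shift: "\<And>j. j < N \<Longrightarrow> norm (\<alpha> (f j) - f (j + 1)) < 1/2"
    and \<tau>: "\<tau> \<in> tracial_states" and m: "m \<ge> 1" "(trace_map \<alpha> ^^ m) \<tau> = \<tau>"
    and N: "m dvd N" "m * L \<le> N"
  shows "real L * Re (\<tau> (f N)) \<le> (\<Sum>j\<le>N. Re (\<tau> (f j)))"
proof -
  have period: "(trace_map \<alpha> ^^ (m * k)) \<tau> = \<tau>" for k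
    by (induction k) (use m(2) in \<open>auto simp: funpow_add\<close>)
  have eq: "\<tau> (f (m * k)) = \<tau> (f 0)" if "m * k \<le> N" for k
    using tracial_state_tower[of \<alpha> N f \<tau> 0 "m * k", OF \<alpha> f shift \<tau>] that by (simp add: period)
  have "real L * Re (\<tau> (f N)) = (\<Sum>k<L. Re (\<tau> (f (m * k))))"
  proof -
    have "m * k \<le> N" if "k < L" for k
      using that N(2) by (meson le_trans less_imp_le mult_le_mono2)
    moreover have "\<tau> (f N) = \<tau> (f 0)" using N(1) eq by (metis dvd_def order.refl)
    ultimately show ?thesis by (simp add: eq)
  qed
  also have "\<dots> = (\<Sum>j\<in>(*) m ` {..<L}. Re (\<tau> (f j)))"
    using m(1) by (subst sum.reindex) (auto simp: inj_on_def)
  also have "\<dots> \<le> (\<Sum>j\<le>N. Re (\<tau> (f j)))"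
  proof (rule sum_mono2)
    show "(*) m ` {..<L} \<subseteq> {..N}"
      using N(2) by (auto intro: le_trans[OF mult_le_mono2[OF less_imp_le]])
  qed (auto intro: tracial_state_projection[OF \<tau> f])
  finally show ?thesis .
qed

text \<open>The shift could leave the range only at \<open>N\<close>, but \<open>N\<close> has
  residue 0 while the target residue is \<open>Suc j\<close>.\<close>

lemma mod_class_shift:
  assumes "j < n" and "Suc n dvd N"
  shows "{i \<in> {..<N}. i mod Suc n = Suc j} = Suc ` {i \<in> {..<N}. i mod Suc n = j}"
proof (intro set_eqI iffI)
  fix i assume i: "i \<in> {i \<in> {..<N}. i mod Suc n = Suc j}"
  then obtain k where "i = Suc k" by (cases i) auto
  then show "i \<in> Suc ` {i \<in> {..<N}. i mod Suc n = j}"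
    using i by (auto simp: mod_Suc split: if_splits)
next
  fix i assume "i \<in> Suc ` {i \<in> {..<N}. i mod Suc n = j}"
  then obtain k where k: "i = Suc k" "k < N" "k mod Suc n = j" by auto
  then have "i mod Suc n = Suc j" using assms(1) by (simp add: mod_Suc)
  moreover have "i \<noteq> N" using calculation assms(2) by auto
  ultimately show "i \<in> {i \<in> {..<N}. i mod Suc n = Suc j}" using k by auto
qed

text \<open>All of \<open>f\<close> is returned with \<open>E\<close>, since bounding the trace of
  the leftover \<open>f N\<close> uses every floor of that tower.\<close>

lemma rokhlin_property_single_tower:
  fixes \<alpha> :: "'a::cstar_algebra \<Rightarrow> 'a"
  assumes \<alpha>: "star_automorphism \<alpha>" and rok: "rokhlin_property \<alpha>"
    and F: "finite F" and \<epsilon>: "\<epsilon> > 0" and N: "Suc n dvd N" "N > 0"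
  obtains E f :: "nat \<Rightarrow> 'a"
  where "\<And>j. projection (E j)" and "\<And>i j. i \<noteq> j \<Longrightarrow> E i * E j = 0"
    and "\<And>j. j < n \<Longrightarrow> norm (\<alpha> (E j) - E (j + 1)) < \<epsilon>"
    and "\<And>a j. a \<in> F \<Longrightarrow> norm (E j * a - a * E j) < \<epsilon>"
    and "1 - (\<Sum>j\<le>n. E j) = f N"
    and "\<And>j. j \<le> N \<Longrightarrow> projection (f j)"
    and "\<And>j. j < N \<Longrightarrow> norm (\<alpha> (f j) - f (j + 1)) < 1/2"
    and "\<And>\<tau>. \<tau> \<in> tracial_states \<Longrightarrow> (\<Sum>j\<le>N. Re (\<tau> (f j))) \<le> 1"
proof -
  \<comment> \<open>Each \<open>E j\<close> has at most \<open>N\<close> summands, each with an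
    error from \<open>e\<close> and one from \<open>f\<close>, so the total is at most
    \<open>2 N \<delta> \<le> \<epsilon> / 2\<close>. The cap \<open>1/2\<close> makes neighbouring
    floors have equal traces.\<close>
  define \<delta> where "\<delta> = min (1/2) (\<epsilon> / (4 * real N))"
  have \<delta>: "\<delta> > 0" "\<delta> \<le> 1/2" using \<epsilon> N by (auto simp: \<delta>_def)
  have N\<delta>: "real N * (2 * \<delta>) < \<epsilon>"
  proof -
    have "\<delta> \<le> \<epsilon> / (4 * real N)" unfolding \<delta>_def by (rule min.cobounded2)
    then have "real N * (2 * \<delta>) \<le> \<epsilon> / 2" using N by (simp add: field_simps)
    then show ?thesis using \<epsilon> by simp
  qed
  obtain e f :: "nat \<Rightarrow> 'a" where
    pe: "\<forall>j<N. projection (e j)" and pf: "\<forall>j\<le>N. projection (f j)" and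
    ee: "\<forall>i<N. \<forall>j<N. i \<noteq> j \<longrightarrow> e i * e j = 0" and
    ff: "\<forall>i\<le>N. \<forall>j\<le>N. i \<noteq> j \<longrightarrow> f i * f j = 0" and
    ef: "\<forall>i<N. \<forall>j\<le>N. e i * f j = 0 \<and> f j * e i = 0" and
    \<alpha>e: "\<forall>j. j + 1 < N \<longrightarrow> norm (\<alpha> (e j) - e (j + 1)) < \<delta>" and
    \<alpha>f: "\<forall>j<N. norm (\<alpha> (f j) - f (j + 1)) < \<delta>" and
    comm: "\<forall>a\<in>F. (\<forall>j<N. norm (e j * a - a * e j) < \<delta>) \<and> (\<forall>j\<le>N. norm (f j * a - a * f j) < \<delta>)" and
    one: "(\<Sum>j<N. e j) + (\<Sum>j\<le>N. f j) = 1"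
    using rok[unfolded rokhlin_property_def, THEN spec, THEN spec, THEN spec, THEN mp,
        OF conjI, OF F \<delta>(1), of N]
    by (elim exE conjE) (rule that; assumption)
  define g where "g = (\<lambda>j. e j + f j)"
  define I where "I = (\<lambda>j. {i \<in> {..<N}. i mod Suc n = j})"
  \<comment> \<open>For \<open>j > n\<close> the residue class is empty and \<open>E j\<close> is 0,
    so the properties free of the shift hold for every \<open>j\<close>.\<close>
  define E where "E = (\<lambda>j. sum g (I j))"
  have pg: "projection (g j)" if "j < N" for j
    using pe pf ef that by (auto simp: g_def projection_def star_add algebra_simps)
  have gg: "g i * g j = 0" if "i < N" "j < N" "i \<noteq> j" for i j
    using ee ff ef that by (simp add: g_def algebra_simps)
  have bound: "norm (\<Sum>i\<in>I j. h i) < \<epsilon>" if "\<And>i. i \<in> I j \<Longrightarrow> norm (h i) \<le> 2 * \<delta>" for h :: "nat \<Rightarrow> 'a" and j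
  proof -
    have "norm (\<Sum>i\<in>I j. h i) \<le> real (card (I j)) * (2 * \<delta>)"
      using that by (rule sum_norm_bound)
    also have "\<dots> \<le> real N * (2 * \<delta>)"
    proof (rule mult_right_mono)
      have "card (I j) \<le> card {..<N}" by (rule card_mono) (auto simp: I_def)
      then show "real (card (I j)) \<le> real N" by simp
    qed (use \<delta> in simp)
    finally show ?thesis using N\<delta> by simp
  qed
  show ?thesis
  proof (rule that[of E f])
    show "projection (E j)" for j
      unfolding E_def by (rule projection_sum) (auto simp: I_def pg gg)
    show "E i * E j = 0" if "i \<noteq> j" for i j
      unfolding E_def using that by (intro orthogonal_sums gg) (auto simp: I_def)
    show "norm (\<alpha> (E j) - E (j + 1)) < \<epsilon>" if "j < n" for j
    proof -
      have shift: "I (j + 1) = Suc ` I j" using mod_class_shift[OF that N(1)] by (simp add: I_def)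
      have "\<alpha> (E j) - E (j + 1) = (\<Sum>i\<in>I j. \<alpha> (g i) - g (Suc i))"
        unfolding E_def shift star_automorphism_sum[OF \<alpha>] by (simp add: sum.reindex sum_subtractf)
      also have "norm \<dots> < \<epsilon>"
      proof (rule bound)
        fix i assume i: "i \<in> I j"
        \<comment> \<open>The top floor of \<open>e\<close> has no shift estimate; it does not occur
          here because \<open>Suc i\<close> stays below \<open>N\<close>.\<close>
        then have "Suc i \<in> I (j + 1)" unfolding shift by blast
        then have "Suc i < N" by (simp add: I_def)
        then have "norm (\<alpha> (e i) - e (Suc i)) < \<delta>" "norm (\<alpha> (f i) - f (Suc i)) < \<delta>"
          using \<alpha>e \<alpha>f by auto
        moreover have "\<alpha> (g i) - g (Suc i) = (\<alpha> (e i) - e (Suc i)) + (\<alpha> (f i) - f (Suc i))"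
          using \<alpha> by (simp add: g_def star_automorphism_def)
        ultimately show "norm (\<alpha> (g i) - g (Suc i)) \<le> 2 * \<delta>"
          using norm_triangle_ineq[of "\<alpha> (e i) - e (Suc i)" "\<alpha> (f i) - f (Suc i)"] by simp
      qed
      finally show ?thesis .
    qed
    show "norm (E j * a - a * E j) < \<epsilon>" if "a \<in> F" for a j
    proof -
      have "E j * a - a * E j = (\<Sum>i\<in>I j. g i * a - a * g i)"
        by (simp add: E_def sum_subtractf sum_distrib_left sum_distrib_right)
      also have "norm \<dots> < \<epsilon>"
      proof (rule bound)
        fix i assume "i \<in> I j"
        then have "norm (e i * a - a * e i) < \<delta>" "norm (f i * a - a * f i) < \<delta>"
          using comm that by (auto simp: I_def)
        moreover have "g i * a - a * g i = (e i * a - a * e i) + (f i * a - a * f i)"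
          by (simp add: g_def algebra_simps)
        ultimately show "norm (g i * a - a * g i) \<le> 2 * \<delta>"
          using norm_triangle_ineq[of "e i * a - a * e i" "f i * a - a * f i"] by simp
      qed
      finally show ?thesis .
    qed
    \<comment> \<open>The residue classes partition the indices below \<open>N\<close>, so
      \<open>f N\<close> is the only floor not covered.\<close>
    have "(\<Sum>j\<le>n. E j) = (\<Sum>i<N. g i)"
      unfolding E_def I_def by (rule sum.group) (auto simp: less_Suc_eq_le[symmetric])
    then show "1 - (\<Sum>j\<le>n. E j) = f N"
      unfolding one[symmetric] by (simp add: g_def sum.distrib flip: lessThan_Suc_atMost)
    show "projection (f j)" if "j \<le> N" for j using pf that by blast
    show "norm (\<alpha> (f j) - f (j + 1)) < 1/2" if "j < N" for j
      using \<alpha>f that \<delta>(2) by (meson less_le_trans)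
    show "(\<Sum>j\<le>N. Re (\<tau> (f j))) \<le> 1" if \<tau>: "\<tau> \<in> tracial_states" for \<tau>
    proof -
      have "1 = Re (\<tau> ((\<Sum>j<N. e j) + (\<Sum>j\<le>N. f j)))" by (simp add: one tracial_state_one[OF \<tau>])
      also have "\<dots> = (\<Sum>j<N. Re (\<tau> (e j))) + (\<Sum>j\<le>N. Re (\<tau> (f j)))"
        by (simp add: tracial_state_add[OF \<tau>] tracial_state_sum[OF \<tau>])
      moreover have "0 \<le> (\<Sum>j<N. Re (\<tau> (e j)))"
        using pe tracial_state_projection[OF \<tau>] by (intro sum_nonneg) auto
      ultimately show ?thesis by linarith
    qed
  qed
qed

section \<open>From the cut towers to the tracial Rokhlin property\<close>

theorem proposition1p7:
  fixes \<alpha> :: "'a::cstar_algebra \<Rightarrow> 'a"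
  assumes "stably_finite TYPE('a)"
    and "simple_cstar TYPE('a)"
    and "real_rank_zero TYPE('a)"
    and "order_determined_by_traces TYPE('a)"
    and "star_automorphism \<alpha>"
    and "trace_map_finite_order \<alpha>"
    and "rokhlin_property \<alpha>"
  shows "tracial_rokhlin_property \<alpha>"
  unfolding tracial_rokhlin_property_def
proof (intro allI impI, elim conjE)
  fix F :: "'a set" and \<epsilon> :: real and n :: nat and x :: 'a
  assume F: "finite F" and \<epsilon>: "\<epsilon> > 0" and "positive x" and x0: "x \<noteq> 0"
  then have "selfadjoint x" by (auto simp: positive_def selfadjoint_def star_mult star_star)
  then obtain d where q: "projection (x * d * x)" "x * d * x \<noteq> 0"
    using real_rank_zero_projection assms(3) x0 by blast
  define q where "q = x * d * x"
  obtain K where K: "\<And>\<tau>. \<tau> \<in> tracial_states \<Longrightarrow> 1 \<le> K * Re (\<tau> q)"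
    using simple_trace_lower_bound[OF assms(2) q] unfolding q_def by blast
  obtain m where m: "m \<ge> 1" "\<And>\<tau> :: 'a \<Rightarrow> complex. \<tau> \<in> tracial_states \<Longrightarrow> (trace_map \<alpha> ^^ m) \<tau> = \<tau>"
    using assms(6) unfolding trace_map_finite_order_def by blast
  \<comment> \<open>The 1 in the maximum secures \<open>L > 0\<close> whatever the sign of
    \<open>K\<close>.\<close>
  obtain L :: nat where "max K 1 < real L" using reals_Archimedean2 by blast
  then have L: "K < real L" "L > 0" by auto
  \<comment> \<open>Divisibility by \<open>Suc n\<close> cuts the towers evenly, divisibility by
    \<open>m\<close> puts the top in the period class of \<open>f 0\<close>, and
    \<open>m * L \<le> N\<close> provides \<open>L\<close> floors of equal trace.\<close>
  define N where "N = Suc n * (m * L)"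
  have N: "Suc n dvd N" "N > 0" "m dvd N" "m * L \<le> N"
    using m(1) L(2) by (auto simp: N_def simp del: mult_Suc)
  obtain E f :: "nat \<Rightarrow> 'a" where E: "\<And>j. projection (E j)" "\<And>i j. i \<noteq> j \<Longrightarrow> E i * E j = 0"
    "\<And>j. j < n \<Longrightarrow> norm (\<alpha> (E j) - E (j + 1)) < \<epsilon>"
    "\<And>a j. a \<in> F \<Longrightarrow> norm (E j * a - a * E j) < \<epsilon>"
    and top: "1 - (\<Sum>j\<le>n. E j) = f N"
    and f: "\<And>j. j \<le> N \<Longrightarrow> projection (f j)"
    "\<And>j. j < N \<Longrightarrow> norm (\<alpha> (f j) - f (j + 1)) < 1/2"
    and sum_le: "\<And>\<tau>. \<tau> \<in> tracial_states \<Longrightarrow> (\<Sum>j\<le>N. Re (\<tau> (f j))) \<le> 1"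
    using rokhlin_property_single_tower[OF assms(5,7) F \<epsilon> N(1,2)] by blast
  \<comment> \<open>For real parts,
    \<open>L \<tau>(f N) \<le> 1 \<le> K \<tau>(q) < L \<tau>(q)\<close>.\<close>
  have less: "\<tau> (f N) < \<tau> q" if \<tau>: "\<tau> \<in> tracial_states" for \<tau>
  proof -
    have fN: "real L * Re (\<tau> (f N)) \<le> 1"
      using tracial_state_tower_top_le[of \<alpha> N f \<tau> m L, OF assms(5) f \<tau> m(1) m(2)[OF \<tau>] N(3,4)] sum_le[OF \<tau>]
      by linarith
    have "0 \<le> Re (\<tau> q)" using tracial_state_projection[OF \<tau>] q by (simp add: q_def)
    moreover have "Re (\<tau> q) \<noteq> 0" using K[OF \<tau>] by auto
    ultimately have "K * Re (\<tau> q) < real L * Re (\<tau> q)" using L(1) by simp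
    then have "real L * Re (\<tau> (f N)) < real L * Re (\<tau> q)" using K[OF \<tau>] fN by linarith
    then have "Re (\<tau> (f N)) < Re (\<tau> q)" using L(2) by simp
    then show ?thesis
      using tracial_state_projection(2)[OF \<tau>] f(1)[of N] q by (simp add: less_complex_def q_def)
  qed
  have "projection (f N)" and "projection q" using f(1)[of N] q(1) by (auto simp: q_def)
  then obtain r where r: "projection r" "r * q = r" "q * r = r" "mvn_equiv (f N) r"
    using trace_comparison[of "f N" q] assms(4) less by metis
  \<comment> \<open>A subprojection of \<open>q = x d x\<close> has the form \<open>x a x\<close>,
    so it lies in the hereditary subalgebra.\<close>
  have "r = q * r * q" by (simp add: r)
  also have "\<dots> = x * (d * x * r * x * d) * x" unfolding q_def by (simp only: mult.assoc)
  finally have "r \<in> hereditary_subalgebra x"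
    unfolding hereditary_subalgebra_def by (intro subsetD[OF closure_subset]) blast
  then show "\<exists>e. (\<forall>j\<le>n. projection (e j)) \<and>
      (\<forall>i\<le>n. \<forall>j\<le>n. i \<noteq> j \<longrightarrow> e i * e j = 0) \<and>
      (\<forall>j<n. norm (\<alpha> (e j) - e (j + 1)) < \<epsilon>) \<and>
      (\<forall>a\<in>F. \<forall>j\<le>n. norm (e j * a - a * e j) < \<epsilon>) \<and>
      (\<exists>q\<in>hereditary_subalgebra x. projection q \<and> mvn_equiv (1 - (\<Sum>j\<le>n. e j)) q)"
    using E r(1,4) unfolding top[symmetric] by (intro exI[of _ E]) blast
qed

end
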